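(* Let $K$ be a field, let $\overline{K}$ be an algebraic closure of $K$, and let $\alpha_1,\ldots,\alpha_m\in\overline{K}$ be elements such that all the extensions $L_i := K(\alpha_i)$ ($i=1,\ldots,m$) are of degree two over $K$. Then the set of extensions $\{L_1,\ldots,L_m\}$ is rationalizable if and only if the field extension $K\subset K(\alpha_1,\ldots,\alpha_m)$ is rationalizable.
   Context: A field extension $K\subset L$ is called rationalizable if there exists a non-zero ring homomorphism $\psi\colon L\to K$ (it is not required to restrict to the identity on $K$). A set $\{L_1,\ldots,L_m\}$ of field extensions of $K$, with inclusions $\iota_i\colon K\hookrightarrow L_i$, is called rationalizable if for each $i$ there is a non-zero ring homomorphism $\psi_i\colon L_i\to K$ such that $\psi_1\circ\iota_1=\cdots=\psi_m\circ\iota_m$. *)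

theory Defs
  imports "HOL-Algebra.Algebra"
begin

definition nonzero_ring_hom ::
    "('a, 'm) ring_scheme \<Rightarrow> ('b, 'n) ring_scheme \<Rightarrow> ('a \<Rightarrow> 'b) set"
  where "nonzero_ring_hom R S = {\<psi> \<in> ring_hom R S. \<exists>x\<in>carrier R. \<psi> x \<noteq> \<zero>\<^bsub>S\<^esub>}"

text \<open>Elements of \<^const>\<open>ring_hom\<close> preserve the unit, so over a nontrivial target the second
  condition is automatic.\<close>

lemma nonzero_ring_hom_eq_ring_hom:
  assumes "ring R" and "\<one>\<^bsub>S\<^esub> \<noteq> \<zero>\<^bsub>S\<^esub>"
  shows "nonzero_ring_hom R S = ring_hom R S"
proof -
  have "\<exists>x\<in>carrier R. \<psi> x \<noteq> \<zero>\<^bsub>S\<^esub>" if "\<psi> \<in> ring_hom R S" for \<psi>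
    using ring_hom_one[OF that] assms ring.ring_simprules(6)[OF assms(1)] by (intro bexI[of _ "\<one>\<^bsub>R\<^esub>"]) auto
  then show ?thesis
    unfolding nonzero_ring_hom_def by blast
qed

text \<open>The homomorphism need not fix \<open>K\<close> pointwise, so the embedding of \<open>K\<close> into \<open>L\<close> plays no
  role in the following notion.\<close>

definition rationalizable :: "('a, 'm) ring_scheme \<Rightarrow> ('b, 'n) ring_scheme \<Rightarrow> bool"
  where "rationalizable K L \<longleftrightarrow> (\<exists>\<psi>. \<psi> \<in> nonzero_ring_hom L K)"

text \<open>A set of extensions of \<open>K\<close> is given as a family \<open>L i\<close> with embeddings
  \<open>\<iota> i\<close> of \<open>K\<close> into \<open>L i\<close>, for \<open>i \<in> I\<close>.  Only the values of the maps on the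
  carrier of \<open>K\<close> are compared, since HOL functions are total.\<close>

definition rationalizable_family ::
    "'i set \<Rightarrow> ('a, 'm) ring_scheme \<Rightarrow> ('i \<Rightarrow> ('b, 'n) ring_scheme) \<Rightarrow> ('i \<Rightarrow> 'a \<Rightarrow> 'b) \<Rightarrow> bool"
  where "rationalizable_family I K L \<iota> \<longleftrightarrow>
    (\<exists>\<psi>. (\<forall>i\<in>I. \<psi> i \<in> nonzero_ring_hom (L i) K) \<and>
         (\<forall>i\<in>I. \<forall>j\<in>I. \<forall>x\<in>carrier K. (\<psi> i \<circ> \<iota> i) x = (\<psi> j \<circ> \<iota> j) x))"

text \<open>\<open>K(A)\<close>, the subfield of \<open>M\<close> generated by \<open>K\<close> and \<open>A\<close>.\<close>

definition adjoin :: "('a, 'm) ring_scheme \<Rightarrow> 'a set \<Rightarrow> 'a set \<Rightarrow> 'a set"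
  where "adjoin M K A = generate_field M (K \<union> A)"

end

theory Submission
  imports Defs
begin

text \<open>Adjoin the \<open>\<alpha> i\<close> one at a time, starting from the common restriction of the \<open>\<psi> i\<close> to
  \<open>K\<close>. If the next \<open>\<alpha> i\<close> already lies in the field \<open>F\<close> reached so far, there is nothing to do.
  Otherwise its minimal polynomial over \<open>F\<close> is still the quadratic one over \<open>K\<close>, so a homomorphism
  \<open>F \<rightarrow> K\<close> extends to \<open>F(\<alpha> i)\<close> by \<open>\<alpha> i \<mapsto> \<psi> i (\<alpha> i)\<close>.\<close>

section \<open>Homomorphisms into a field and generated subfields\<close>

lemma nonzero_ring_hom_to_field:
  assumes "ring R" "field S"
  shows "nonzero_ring_hom R S = ring_hom R S"
  using assms domain.one_not_zero[OF field.axioms(1)] by (intro nonzero_ring_hom_eq_ring_hom) auto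

text \<open>Membership in \<open>ring_hom\<close> constrains values on the carrier only, so
  restricting a homomorphism leaves the HOL function itself unchanged.\<close>

lemma ring_hom_restrict_carrier:
  assumes "\<psi> \<in> ring_hom (R\<lparr>carrier := B\<rparr>) S" "A \<subseteq> B"
  shows "\<psi> \<in> ring_hom (R\<lparr>carrier := A\<rparr>) S"
  using assms unfolding ring_hom_def by (auto simp: subset_iff)

lemma (in field) adjoin_subfield:
  assumes "K \<subseteq> carrier R" "A \<subseteq> carrier R"
  shows "subfield (adjoin R K A) R" "K \<subseteq> adjoin R K A" "A \<subseteq> adjoin R K A"
  using generate_fieldE(1,2)[OF _ refl, of "K \<union> A"] assms unfolding adjoin_def by auto

lemma (in field) adjoin_mono:
  assumes "K \<subseteq> carrier R" "B \<subseteq> carrier R" "A \<subseteq> B"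
  shows "adjoin R K A \<subseteq> adjoin R K B"
  unfolding adjoin_def using assms by (intro mono_generate_field) auto

lemma (in field) adjoin_empty:
  assumes "subfield K R"
  shows "adjoin R K {} = K"
  unfolding adjoin_def
  using generate_field_min_subfield1[OF _ assms] subfieldE(3)[OF assms]
  by (auto intro: generate_field.incl)

section \<open>Quadratic elements and extension of homomorphisms\<close>

text \<open>If \<alpha> lies outside \<open>K\<close>, then \<alpha> and 1 are independent, hence a
  basis of the two-dimensional \<open>E\<close>, and the square of \<alpha> expands in it. If
  \<alpha> lies in \<open>K\<close>, the coefficients \<alpha> and 0 do.\<close>

lemma (in field) quadratic_relation:
  assumes K: "subfield K R" and E: "subfield E R" "K \<subseteq> E" "\<alpha> \<in> E" and dim: "dimension 2 K E"
  obtains a b where "a \<in> K" "b \<in> K" "\<alpha> \<otimes> \<alpha> = a \<otimes> \<alpha> \<oplus> b"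
proof (cases "\<alpha> \<in> K")
  case True
  have "\<alpha> \<otimes> \<alpha> = \<alpha> \<otimes> \<alpha> \<oplus> \<zero>"
    using True subfieldE(3)[OF K] by auto
  then show thesis
    using that[OF True subringE(2)[OF subfieldE(1)[OF K]]] by blast
next
  case False
  note KR = subringE[OF subfieldE(1)[OF K]]
  have car: "\<alpha> \<in> carrier R"
    using E subfieldE(3) by blast
  have span1: "Span K [\<one>] = K"
    using KR(1,2) by (force simp: line_extension_mem_iff)
  have "independent K [\<alpha>, \<one>]"
    using False car span1 by (intro li_Cons) auto
  moreover have "set [\<alpha>, \<one>] \<subseteq> E"
    using E subringE(3)[OF subfieldE(1)[OF E(1)]] by auto
  ultimately have "Span K [\<alpha>, \<one>] = E"
    using independent_length_eq_dimension[OF K dim, of "[\<alpha>, \<one>]"] by auto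
  moreover have "\<alpha> \<otimes> \<alpha> \<in> E"
    using E subringE(6)[OF subfieldE(1)[OF E(1)]] by auto
  ultimately have "\<alpha> \<otimes> \<alpha> \<in> line_extension K \<alpha> K"
    using span1 by simp
  then show thesis
    using that unfolding line_extension_mem_iff by blast
qed

text \<open>Elements of \<open>simple_extension F \<alpha>\<close> arise by Horner steps,
  multiplying by \<alpha> and adding a constant. A step applied to a linear expression produces one
  square of \<alpha>, which the relation makes linear again.\<close>

lemma (in field) simple_extension_quadratic:
  assumes F: "subring F R" and \<alpha>: "\<alpha> \<in> carrier R"
    and ab: "a \<in> F" "b \<in> F" "\<alpha> \<otimes> \<alpha> = a \<otimes> \<alpha> \<oplus> b"
  shows "simple_extension F \<alpha> \<subseteq> {x \<otimes> \<alpha> \<oplus> y | x y. x \<in> F \<and> y \<in> F}"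
proof
  note FR = subringE[OF F]
  fix z assume "z \<in> simple_extension F \<alpha>"
  then show "z \<in> {x \<otimes> \<alpha> \<oplus> y | x y. x \<in> F \<and> y \<in> F}"
  proof induction
    case zero
    have "\<zero> = \<zero> \<otimes> \<alpha> \<oplus> \<zero>"
      using \<alpha> by simp
    then show ?case using FR(2) by blast
  next
    case (lin z k)
    then obtain x y where z: "z = x \<otimes> \<alpha> \<oplus> y" "x \<in> F" "y \<in> F"
      by blast
    have "z \<otimes> \<alpha> \<oplus> k = x \<otimes> (\<alpha> \<otimes> \<alpha>) \<oplus> (y \<otimes> \<alpha> \<oplus> k)"
      using z lin FR(1) \<alpha> by (simp add: subset_iff) algebra
    also have "\<dots> = (x \<otimes> a \<oplus> y) \<otimes> \<alpha> \<oplus> (x \<otimes> b \<oplus> k)"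
      unfolding ab(3) using z lin FR(1) \<alpha> ab by (simp add: subset_iff) algebra
    finally show ?case
      using z lin ab FR(6,7) by blast
  qed
qed

text \<open>For \<alpha> outside \<open>F\<close>, the extension sends
  \<open>x \<otimes> \<alpha> \<oplus> y\<close> to the same expression with \<beta> for \<alpha>
  and with \<psi> applied to the coefficients. It is well defined because 1 and \<alpha> are
  independent over \<open>F\<close>, and multiplicative because \<beta> satisfies the \<psi>-image
  of the relation for \<alpha>.\<close>

lemma (in field) ring_hom_extend_quadratic:
  assumes F: "subfield F R" and S: "cring S" and \<psi>: "\<psi> \<in> ring_hom (R\<lparr>carrier := F\<rparr>) S"
    and \<alpha>: "\<alpha> \<in> carrier R"
    and ab: "a \<in> F" "b \<in> F" "\<alpha> \<otimes> \<alpha> = a \<otimes> \<alpha> \<oplus> b"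
    and \<beta>: "\<beta> \<in> carrier S" "\<beta> \<otimes>\<^bsub>S\<^esub> \<beta> = \<psi> a \<otimes>\<^bsub>S\<^esub> \<beta> \<oplus>\<^bsub>S\<^esub> \<psi> b"
  obtains \<chi> where "\<chi> \<in> ring_hom (R\<lparr>carrier := simple_extension F \<alpha>\<rparr>) S" "\<And>x. x \<in> F \<Longrightarrow> \<chi> x = \<psi> x"
proof (cases "\<alpha> \<in> F")
  \<comment> \<open>Here \<psi> itself serves. The root \<beta> may differ from
    \<open>\<psi> \<alpha>\<close>, which does no harm: the conclusion prescribes \<chi> only on
    \<open>F\<close>.\<close>
  case True
  then have "simple_extension F \<alpha> \<subseteq> F"
    using simple_extension_subring_incl[OF subfieldE(1)[OF F]] by blast
  then show thesis
    using that[of \<psi>] \<psi> ring_hom_restrict_carrier by blast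
next
  case False
  interpret S: cring S by (fact S)
  note FR = subringE[OF subfieldE(1)[OF F]]
  have Fc [simp]: "x \<in> F \<Longrightarrow> x \<in> carrier R" for x
    using FR(1) by blast
  have \<psi>F [simp]: "x \<in> F \<Longrightarrow> \<psi> x \<in> carrier S" "\<psi> \<one> = \<one>\<^bsub>S\<^esub>"
    "x \<in> F \<Longrightarrow> y \<in> F \<Longrightarrow> \<psi> (x \<otimes> y) = \<psi> x \<otimes>\<^bsub>S\<^esub> \<psi> y"
    "x \<in> F \<Longrightarrow> y \<in> F \<Longrightarrow> \<psi> (x \<oplus> y) = \<psi> x \<oplus>\<^bsub>S\<^esub> \<psi> y" for x y
    using ring_hom_memE[OF \<psi>] by auto
  have \<psi>0: "\<psi> \<zero> = \<zero>\<^bsub>S\<^esub>"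
    using ring_hom_zero[OF \<psi> subring_is_ring[OF subfieldE(1)[OF F]] S.ring_axioms] by simp
  \<comment> \<open>Subtracting the two expressions puts
    \<open>(x \<ominus> x') \<otimes> \<alpha>\<close> into \<open>F\<close>; if
    \<open>x \<ominus> x'\<close> were nonzero, dividing by it would put \<alpha> into
    \<open>F\<close>.\<close>
  have uniq: "x = x' \<and> y = y'"
    if F4: "x \<in> F" "y \<in> F" "x' \<in> F" "y' \<in> F" and eq: "x \<otimes> \<alpha> \<oplus> y = x' \<otimes> \<alpha> \<oplus> y'" for x y x' y'
  proof -
    have c: "x \<in> carrier R" "y \<in> carrier R" "x' \<in> carrier R" "y' \<in> carrier R"
      using F4 by auto
    have "(x \<ominus> x') \<otimes> \<alpha> = (x \<otimes> \<alpha> \<oplus> y) \<ominus> y \<ominus> x' \<otimes> \<alpha>"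
      using c \<alpha> by algebra
    also have "\<dots> = y' \<ominus> y"
      unfolding eq using c \<alpha> by algebra
    finally have "(x \<ominus> x') \<otimes> \<alpha> \<in> F"
      using F4 FR(5,7) by (simp add: a_minus_def)
    moreover have "x \<ominus> x' \<in> F"
      using F4 FR(5,7) by (simp add: a_minus_def)
    ultimately have "x \<ominus> x' = \<zero>"
      using subfield_m_inv_simprule[OF F, of "x \<ominus> x'" \<alpha>] \<alpha> False by blast
    then have "x = x'"
      using c by simp
    then show ?thesis
      using eq c \<alpha> by simp
  qed
  \<comment> \<open>The choice operator picks a pair of coefficients for \<open>z\<close>; by
    \<open>uniq\<close> there is at most one pair, and on the simple extension there is one.\<close>
  define \<chi> where "\<chi> z = (case SOME (x, y). x \<in> F \<and> y \<in> F \<and> z = x \<otimes> \<alpha> \<oplus> y of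
      (x, y) \<Rightarrow> \<psi> x \<otimes>\<^bsub>S\<^esub> \<beta> \<oplus>\<^bsub>S\<^esub> \<psi> y)" for z
  have \<chi>: "\<chi> (x \<otimes> \<alpha> \<oplus> y) = \<psi> x \<otimes>\<^bsub>S\<^esub> \<beta> \<oplus>\<^bsub>S\<^esub> \<psi> y" if "x \<in> F" "y \<in> F" for x y
  proof -
    have "(SOME (x', y'). x' \<in> F \<and> y' \<in> F \<and> x \<otimes> \<alpha> \<oplus> y = x' \<otimes> \<alpha> \<oplus> y') = (x, y)"
      by (rule some_equality) (use that uniq in auto)
    then show ?thesis
      unfolding \<chi>_def by simp
  qed
  have E: "\<exists>x y. x \<in> F \<and> y \<in> F \<and> z = x \<otimes> \<alpha> \<oplus> y" if "z \<in> simple_extension F \<alpha>" for z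
    using simple_extension_quadratic[OF subfieldE(1)[OF F] \<alpha> ab] that by blast
  have \<chi>F: "\<chi> y = \<psi> y" if "y \<in> F" for y
    using \<chi>[OF FR(2) that] that \<alpha> \<beta> by (simp add: \<psi>0)
  have "\<chi> \<in> ring_hom (R\<lparr>carrier := simple_extension F \<alpha>\<rparr>) S"
  proof (rule ring_hom_memI; simp)
    fix z assume "z \<in> simple_extension F \<alpha>"
    then show "\<chi> z \<in> carrier S"
      using E[of z] \<beta> by (auto simp: \<chi>)
  next
    show "\<chi> \<one> = \<one>\<^bsub>S\<^esub>"
      using \<chi>F FR(3) by simp
  next
    fix z w assume "z \<in> simple_extension F \<alpha>" "w \<in> simple_extension F \<alpha>"
    then obtain x y u v where F4: "x \<in> F" "y \<in> F" "u \<in> F" "v \<in> F"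
      and zw: "z = x \<otimes> \<alpha> \<oplus> y" "w = u \<otimes> \<alpha> \<oplus> v"
      using E by meson
    have c: "x \<in> carrier R" "y \<in> carrier R" "u \<in> carrier R" "v \<in> carrier R"
        "a \<in> carrier R" "b \<in> carrier R"
      and d: "\<psi> x \<in> carrier S" "\<psi> y \<in> carrier S" "\<psi> u \<in> carrier S" "\<psi> v \<in> carrier S"
        "\<psi> a \<in> carrier S" "\<psi> b \<in> carrier S"
      using F4 ab by auto
    have "z \<oplus> w = (x \<oplus> u) \<otimes> \<alpha> \<oplus> (y \<oplus> v)"
      unfolding zw using c \<alpha> by algebra
    then have "\<chi> (z \<oplus> w) = (\<psi> x \<oplus>\<^bsub>S\<^esub> \<psi> u) \<otimes>\<^bsub>S\<^esub> \<beta> \<oplus>\<^bsub>S\<^esub> (\<psi> y \<oplus>\<^bsub>S\<^esub> \<psi> v)"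
      using F4 FR(7) by (simp add: \<chi>)
    also have "\<dots> = \<chi> z \<oplus>\<^bsub>S\<^esub> \<chi> w"
      unfolding zw \<chi>[OF F4(1,2)] \<chi>[OF F4(3,4)] using d \<beta>(1) by algebra
    finally show "\<chi> (z \<oplus> w) = \<chi> z \<oplus>\<^bsub>S\<^esub> \<chi> w" .
    have "z \<otimes> w = (x \<otimes> u) \<otimes> (\<alpha> \<otimes> \<alpha>) \<oplus> (x \<otimes> v \<oplus> y \<otimes> u) \<otimes> \<alpha> \<oplus> y \<otimes> v"
      unfolding zw using c \<alpha> by algebra
    also have "\<dots> = (x \<otimes> u \<otimes> a \<oplus> (x \<otimes> v \<oplus> y \<otimes> u)) \<otimes> \<alpha> \<oplus> (x \<otimes> u \<otimes> b \<oplus> y \<otimes> v)"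
      unfolding ab(3) using c \<alpha> by algebra
    finally have "\<chi> (z \<otimes> w) =
        (\<psi> x \<otimes>\<^bsub>S\<^esub> \<psi> u \<otimes>\<^bsub>S\<^esub> \<psi> a \<oplus>\<^bsub>S\<^esub> (\<psi> x \<otimes>\<^bsub>S\<^esub> \<psi> v \<oplus>\<^bsub>S\<^esub> \<psi> y \<otimes>\<^bsub>S\<^esub> \<psi> u)) \<otimes>\<^bsub>S\<^esub> \<beta>
          \<oplus>\<^bsub>S\<^esub> (\<psi> x \<otimes>\<^bsub>S\<^esub> \<psi> u \<otimes>\<^bsub>S\<^esub> \<psi> b \<oplus>\<^bsub>S\<^esub> \<psi> y \<otimes>\<^bsub>S\<^esub> \<psi> v)"
      using F4 FR(6,7) ab(1,2) by (simp add: \<chi>)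
    also have "\<dots> = (\<psi> x \<otimes>\<^bsub>S\<^esub> \<psi> u) \<otimes>\<^bsub>S\<^esub> (\<psi> a \<otimes>\<^bsub>S\<^esub> \<beta> \<oplus>\<^bsub>S\<^esub> \<psi> b)
        \<oplus>\<^bsub>S\<^esub> (\<psi> x \<otimes>\<^bsub>S\<^esub> \<psi> v \<oplus>\<^bsub>S\<^esub> \<psi> y \<otimes>\<^bsub>S\<^esub> \<psi> u) \<otimes>\<^bsub>S\<^esub> \<beta> \<oplus>\<^bsub>S\<^esub> \<psi> y \<otimes>\<^bsub>S\<^esub> \<psi> v"
      using d \<beta>(1) by algebra
    also have "\<dots> = \<chi> z \<otimes>\<^bsub>S\<^esub> \<chi> w"
      unfolding zw \<chi>[OF F4(1,2)] \<chi>[OF F4(3,4)] \<beta>(2)[symmetric] using d \<beta>(1) by algebra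
    finally show "\<chi> (z \<otimes> w) = \<chi> z \<otimes>\<^bsub>S\<^esub> \<chi> w" .
  qed
  then show thesis
    using that \<chi>F by blast
qed

section \<open>Adjoining finitely many quadratic elements\<close>

text \<open>Since \<alpha> is algebraic over \<open>K\<close>, hence over
  \<open>adjoin L K A\<close>, the ring obtained by adjoining it is already a field, so it contains
  the generated one. This inclusion suffices for restricting homomorphisms.\<close>

lemma (in algebraic_closure) adjoin_insert_le:
  assumes "A \<subseteq> carrier L" "\<alpha> \<in> carrier L"
  shows "adjoin L K (insert \<alpha> A) \<subseteq> simple_extension (adjoin L K A) \<alpha>"
proof -
  have K: "subfield K L" "K \<subseteq> carrier L"
    using subfield_axioms subfieldE(3) by auto
  note A = adjoin_subfield[OF K(2) assms(1)]
  note F = subfieldE(1,3)[OF A(1)]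
  have "(algebraic over adjoin L K A) \<alpha>"
    using algebraic_mono[OF A(2)] algebraic_extension[OF assms(2)] by blast
  then have "subfield (simple_extension (adjoin L K A) \<alpha>) L"
    using simple_extension_is_subfield[OF A(1) assms(2)] by blast
  then show ?thesis
    using A(2,3) simple_extension_incl[OF F(2) assms(2)] simple_extension_mem[OF F(1) assms(2)]
      K assms
    unfolding adjoin_def[of L K "insert \<alpha> A"] by (intro generate_field_min_subfield1) auto
qed

lemma (in algebraic_closure) ring_hom_extend_adjoin:
  assumes "finite I" and S: "cring S" and \<phi>: "\<phi> \<in> ring_hom (L\<lparr>carrier := K\<rparr>) S"
    and "\<And>i. i \<in> I \<Longrightarrow> \<alpha> i \<in> carrier L"
    and "\<And>i. i \<in> I \<Longrightarrow> dimension 2 K (adjoin L K {\<alpha> i})"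
    and "\<And>i. i \<in> I \<Longrightarrow> \<psi> i \<in> ring_hom (L\<lparr>carrier := adjoin L K {\<alpha> i}\<rparr>) S"
    and "\<And>i x. i \<in> I \<Longrightarrow> x \<in> K \<Longrightarrow> \<psi> i x = \<phi> x"
  shows "\<exists>\<chi> \<in> ring_hom (L\<lparr>carrier := adjoin L K (\<alpha> ` I)\<rparr>) S. \<forall>x\<in>K. \<chi> x = \<phi> x"
  using assms(1,4-)
proof (induction I)
  case empty
  then show ?case
    using \<phi> adjoin_empty[OF subfield_axioms] by auto
next
  case (insert i I)
  have K: "subfield K L" "K \<subseteq> carrier L"
    using subfield_axioms subfieldE(3) by auto
  obtain \<chi> where \<chi>: "\<chi> \<in> ring_hom (L\<lparr>carrier := adjoin L K (\<alpha> ` I)\<rparr>) S" "\<forall>x\<in>K. \<chi> x = \<phi> x"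
    using insert by auto
  have \<alpha>: "\<alpha> i \<in> carrier L" and I: "\<alpha> ` I \<subseteq> carrier L"
    using insert.prems(1) by auto
  note E = adjoin_subfield[OF K(2), of "{\<alpha> i}"] and F = adjoin_subfield[OF K(2) I]
  have \<alpha>E: "\<alpha> i \<in> adjoin L K {\<alpha> i}"
    using E \<alpha> by auto
  \<comment> \<open>The coefficients are taken in \<open>K\<close>, not merely in the field reached
    so far: on \<open>K\<close> both \<open>\<psi> i\<close> and \<chi> agree with \<phi>, so the
    relation satisfied by \<open>\<psi> i (\<alpha> i)\<close> can be rewritten with coefficients
    \<open>\<chi> a\<close> and \<open>\<chi> b\<close>.\<close>
  obtain a b where ab: "a \<in> K" "b \<in> K" "\<alpha> i \<otimes> \<alpha> i = a \<otimes> \<alpha> i \<oplus> b"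
    using quadratic_relation[OF K(1) E(1,2) \<alpha>E] \<alpha> insert.prems(2) by auto
  have abE: "a \<in> adjoin L K {\<alpha> i}" "b \<in> adjoin L K {\<alpha> i}"
    using E(2) \<alpha> ab by auto
  have h: "\<psi> i \<in> ring_hom (L\<lparr>carrier := adjoin L K {\<alpha> i}\<rparr>) S"
    using insert.prems(3) by simp
  have "a \<otimes> \<alpha> i \<in> adjoin L K {\<alpha> i}"
    using subringE(6)[OF subfieldE(1)[OF E(1)]] \<alpha> abE \<alpha>E by auto
  then have "\<psi> i (\<alpha> i) \<otimes>\<^bsub>S\<^esub> \<psi> i (\<alpha> i) = \<psi> i a \<otimes>\<^bsub>S\<^esub> \<psi> i (\<alpha> i) \<oplus>\<^bsub>S\<^esub> \<psi> i b"
    using ring_hom_memE(2)[OF h, of "\<alpha> i" "\<alpha> i"] ring_hom_memE(2)[OF h, of a "\<alpha> i"]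
      ring_hom_memE(3)[OF h, of "a \<otimes> \<alpha> i" b] abE \<alpha>E ab(3) by simp
  then have rel: "\<psi> i (\<alpha> i) \<otimes>\<^bsub>S\<^esub> \<psi> i (\<alpha> i) = \<chi> a \<otimes>\<^bsub>S\<^esub> \<psi> i (\<alpha> i) \<oplus>\<^bsub>S\<^esub> \<chi> b"
    using insert.prems(4)[of i] ab \<chi>(2) by simp
  have "\<psi> i (\<alpha> i) \<in> carrier S"
    using ring_hom_memE(1)[OF h] \<alpha>E by simp
  then obtain \<omega> where \<omega>: "\<omega> \<in> ring_hom (L\<lparr>carrier := simple_extension (adjoin L K (\<alpha> ` I)) (\<alpha> i)\<rparr>) S"
    "\<And>x. x \<in> adjoin L K (\<alpha> ` I) \<Longrightarrow> \<omega> x = \<chi> x"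
    using ring_hom_extend_quadratic[OF F(1) S \<chi>(1) \<alpha> _ _ ab(3) _ rel] ab F(2) by blast
  have "\<omega> \<in> ring_hom (L\<lparr>carrier := adjoin L K (\<alpha> ` insert i I)\<rparr>) S"
    using ring_hom_restrict_carrier[OF \<omega>(1)] adjoin_insert_le[OF I \<alpha>] by simp
  moreover have "\<forall>x\<in>K. \<omega> x = \<phi> x"
    using \<omega>(2) \<chi>(2) F(2) by auto
  ultimately show ?case
    by blast
qed

section \<open>Equivalence of the two rationalizability conditions\<close>

theorem theorem1p5:
  fixes Kbar :: "('a, 'b) ring_scheme" and K :: "'a set"
    and \<alpha> :: "nat \<Rightarrow> 'a" and m :: nat
  assumes "algebraic_closure Kbar K"
    and "\<And>i. i \<in> {1..m} \<Longrightarrow> \<alpha> i \<in> carrier Kbar"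
    and "\<And>i. i \<in> {1..m} \<Longrightarrow> ring.dimension Kbar 2 K (adjoin Kbar K {\<alpha> i})"
  shows "rationalizable_family {1..m} (Kbar\<lparr>carrier := K\<rparr>)
           (\<lambda>i. Kbar\<lparr>carrier := adjoin Kbar K {\<alpha> i}\<rparr>) (\<lambda>i. id)
         \<longleftrightarrow> rationalizable (Kbar\<lparr>carrier := K\<rparr>)
               (Kbar\<lparr>carrier := adjoin Kbar K (\<alpha> ` {1..m})\<rparr>)"
proof -
  interpret algebraic_closure Kbar K by (fact assms(1))
  let ?K = "Kbar\<lparr>carrier := K\<rparr>"
  let ?E = "\<lambda>A. Kbar\<lparr>carrier := adjoin Kbar K A\<rparr>"
  have K: "subfield K Kbar" "K \<subseteq> carrier Kbar"
    using subfield_axioms subfieldE(3) by auto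
  have fK: "field ?K"
    using subfield_iff(2)[OF K(1)] .
  have \<alpha>: "\<alpha> ` {1..m} \<subseteq> carrier Kbar"
    using assms(2) by blast
  \<comment> \<open>The target is a field, so unital homomorphisms are automatically nonzero and
    both conditions reduce to plain \<open>ring_hom\<close> membership.\<close>
  have hom_eq: "nonzero_ring_hom (?E A) ?K = ring_hom (?E A) ?K" if "A \<subseteq> carrier Kbar" for A
    using adjoin_subfield(1)[OF K(2) that] fK
    by (intro nonzero_ring_hom_to_field subring_is_ring subfieldE(1))
  show ?thesis
  proof
    assume "rationalizable_family {1..m} ?K (\<lambda>i. ?E {\<alpha> i}) (\<lambda>i. id)"
    then obtain \<psi> where nz: "\<forall>i\<in>{1..m}. \<psi> i \<in> nonzero_ring_hom (?E {\<alpha> i}) ?K"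
      and eq: "\<forall>i\<in>{1..m}. \<forall>j\<in>{1..m}. \<forall>x\<in>K. \<psi> i x = \<psi> j x"
      unfolding rationalizable_family_def by auto
    have \<psi>: "\<psi> i \<in> ring_hom (?E {\<alpha> i}) ?K" if "i \<in> {1..m}" for i
      using bspec[OF nz that] unfolding nonzero_ring_hom_def by blast
    \<comment> \<open>\<phi> is the restriction of \<open>\<psi> 1\<close> to \<open>K\<close>,
      equal to that of every other \<open>\<psi> i\<close> by compatibility. For
      \<open>m = 0\<close> there is no map to restrict, and the identity is taken instead.\<close>
    obtain \<phi> where \<phi>: "\<phi> \<in> ring_hom ?K ?K" "\<And>i x. i \<in> {1..m} \<Longrightarrow> x \<in> K \<Longrightarrow> \<psi> i x = \<phi> x"
    proof (cases "m = 0")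
      case True
      then show thesis
        using that[of id] id_ring_hom by auto
    next
      case False
      then have 1: "1 \<in> {1..m}"
        by simp
      then have "\<psi> 1 \<in> ring_hom ?K ?K"
        using ring_hom_restrict_carrier[OF \<psi>[OF 1]] adjoin_subfield(2)[OF K(2), of "{\<alpha> 1}"] assms(2) by blast
      then show thesis
        using that eq 1 by blast
    qed
    have "cring ?K"
      using fK fieldE(1) by blast
    then have "\<exists>\<chi>\<in>ring_hom (?E (\<alpha> ` {1..m})) ?K. \<forall>x\<in>K. \<chi> x = \<phi> x"
      by (rule ring_hom_extend_adjoin[OF finite_atLeastAtMost _ \<phi>(1) assms(2,3) \<psi> \<phi>(2)])
    then obtain \<chi> where "\<chi> \<in> ring_hom (?E (\<alpha> ` {1..m})) ?K"
      by (elim bexE)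
    then show "rationalizable ?K (?E (\<alpha> ` {1..m}))"
      unfolding rationalizable_def hom_eq[OF \<alpha>] by blast
  next
    assume "rationalizable ?K (?E (\<alpha> ` {1..m}))"
    then obtain \<psi> where \<psi>: "\<psi> \<in> ring_hom (?E (\<alpha> ` {1..m})) ?K"
      unfolding rationalizable_def hom_eq[OF \<alpha>] by (elim exE)
    \<comment> \<open>Each \<open>K(\<alpha> i)\<close> lies in the full compositum, so one \<psi>
      restricts to all of them; using the constant family makes compatibility on \<open>K\<close>
      immediate.\<close>
    have "\<psi> \<in> nonzero_ring_hom (?E {\<alpha> i}) ?K" if "i \<in> {1..m}" for i
    proof -
      have "{\<alpha> i} \<subseteq> \<alpha> ` {1..m}"
        using that by simp
      then have "\<psi> \<in> ring_hom (?E {\<alpha> i}) ?K"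
        using ring_hom_restrict_carrier[OF \<psi>] adjoin_mono[OF K(2) \<alpha>] by simp
      then show ?thesis
        using hom_eq[of "{\<alpha> i}"] assms(2)[OF that] by simp
    qed
    then show "rationalizable_family {1..m} ?K (\<lambda>i. ?E {\<alpha> i}) (\<lambda>i. id)"
      unfolding rationalizable_family_def by (intro exI[of _ "\<lambda>_. \<psi>"]) auto
  qed
qed

end
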